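(* Let $0<v<+\infty$, $\alpha>0$, $c>0$, $\mu=\int_0^{+\infty}(1-F(z))\,dz<\infty$ and $p=\alpha\mu/c<1$. Let $\varphi^0:[0,v]\to[0,1]$ be nondecreasing and define $$\varphi^{k+1}(u)=1-\frac{\alpha\mu}{c}+\frac{\alpha}{c}\int_0^u\varphi^k(u-z)[1-F(z)]\,dz,\qquad u\in[0,v],\ k=0,1,\dots$$ Then: (i) all $\varphi^k$, $k\ge1$, are continuous and nondecreasing on $[0,v]$, and $0\le\varphi^k(u)\le1$; (ii) the sequence $\{\varphi^k\}$ is a Cauchy sequence in the space of continuous functions on $[0,v]$ with the norm $\|f\|=\max_{u\in[0,v]}|f(u)|$; it converges to the solution $\varphi$ of $$\varphi(u)=1-\frac{\alpha\mu}{c}+\frac{\alpha}{c}\int_0^u\varphi(u-z)[1-F(z)]\,dz,\qquad u\in[0,v],$$ and $\|\varphi-\varphi^k\|\le\dfrac{p^k}{1-p}$; (iii) the limit function $\varphi(u)=\lim_{k\to\infty}\varphi^k(u)$ is continuous and nondecreasing, and $0\le\varphi(u)\le1$.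
   Context: $F$ is the distribution function of claim sizes, $F(z)=0$ for $z\le0$, with mean $\mu$. *)

theory Defs
  imports "HOL-Probability.Probability"
begin

text \<open>On \<open>[0, v]\<close> a continuous function attains its maximal modulus, so for continuous
  \<open>f\<close> this is the maximum norm. The supremum also makes sense for the starting iterate, which
  is bounded but possibly discontinuous.\<close>

definition max_norm :: "real \<Rightarrow> (real \<Rightarrow> real) \<Rightarrow> real" where
  "max_norm v f = (SUP u\<in>{0..v}. \<bar>f u\<bar>)"

text \<open>Right-hand side of the integral equation. Only the values of \<open>\<phi>\<close> on \<open>[0, u]\<close> matter.\<close>

definition renewal_op ::
  "real \<Rightarrow> real \<Rightarrow> real \<Rightarrow> (real \<Rightarrow> real) \<Rightarrow> (real \<Rightarrow> real) \<Rightarrow> real \<Rightarrow> real" where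
  "renewal_op \<alpha> c \<mu> F \<phi> u =
     1 - \<alpha> * \<mu> / c + \<alpha> / c * (LBINT z:{0..u}. \<phi> (u - z) * (1 - F z))"

text \<open>The library's metric space of continuous functions on \<open>[0, v]\<close> with the supremum
  distance; its elements are functions extensional on \<open>[0, v]\<close>.\<close>

abbreviation C_space :: "real \<Rightarrow> (real \<Rightarrow> real) metric" where
  "C_space v \<equiv> cfunspace (top_of_set {0..v}) euclidean_metric"

end

theory Submission
  imports Defs
begin

text \<open>Extending \<open>\<phi>\<close> by zero outside \<open>[0, v]\<close> turns the integral over \<open>[0, u]\<close> into a convolution
  over the whole line with the integrable kernel \<open>1\<^bsub>[0,\<infinity>)\<^esub> (1 - F)\<close>, whose total mass is \<open>\<mu>\<close>.
  Hence the right-hand side of the equation is a contraction with constant \<open>p = \<alpha> \<mu> / c\<close> in the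
  supremum norm, and the geometric estimate of the Banach fixed point theorem gives convergence,
  the error bound and uniqueness. A monotone function has only countably many discontinuities, so
  dominated convergence makes the image of a monotone function continuous.\<close>

text \<open>Source of measurability for the iterates and their limit: all of them are monotone on
  [0, v], whereas the starting one may jump.\<close>

lemma mono_on_imp_set_borel_measurable:
  fixes \<phi> :: "real \<Rightarrow> real"
  assumes "mono_on A \<phi>" and "A \<in> sets borel"
  shows "set_borel_measurable borel A \<phi>"
  using borel_measurable_mono_on_fnc[OF assms(1)] assms(2)
  by (simp add: set_borel_measurable_def borel_measurable_restrict_space_iff)

section \<open>The integral operator as a convolution\<close>

locale renewal_kernel =
  fixes v \<alpha> c \<mu> :: real and F :: "real \<Rightarrow> real"
  assumes \<alpha>_pos: "\<alpha> > 0" and c_pos: "c > 0"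
    and F_measurable [measurable]: "F \<in> borel_measurable borel"
    and F_le_1: "F z \<le> 1"
    and integrable_tail: "set_integrable lborel {0..} (\<lambda>z. 1 - F z)"
    and \<mu>_eq: "\<mu> = (LBINT z:{0..}. 1 - F z)"
begin

definition ext :: "(real \<Rightarrow> real) \<Rightarrow> real \<Rightarrow> real" where
  "ext \<phi> x = indicator {0..v} x * \<phi> x"

definition kern :: "real \<Rightarrow> real" where
  "kern z = indicator {0..} z * (1 - F z)"

abbreviation T :: "(real \<Rightarrow> real) \<Rightarrow> real \<Rightarrow> real" where
  "T \<equiv> renewal_op \<alpha> c \<mu> F"

lemma kern_nonneg: "0 \<le> kern z"
  using F_le_1[of z] by (simp add: kern_def)

lemma kern_measurable [measurable]: "kern \<in> borel_measurable borel"
  unfolding kern_def by measurable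

lemma integrable_kern: "integrable lborel kern"
  using integrable_tail by (simp add: set_integrable_def kern_def[abs_def])

lemma integral_kern: "(\<integral>z. kern z \<partial>lborel) = \<mu>"
  by (simp add: \<mu>_eq set_lebesgue_integral_def kern_def)

lemma \<mu>_nonneg: "0 \<le> \<mu>"
  using Bochner_Integration.integral_nonneg[of lborel kern] kern_nonneg integral_kern by simp

lemma ext_measurable:
  "set_borel_measurable borel {0..v} \<phi> \<Longrightarrow> ext \<phi> \<in> borel_measurable borel"
  by (simp add: set_borel_measurable_def ext_def[abs_def])

lemma renewal_op_eq_convolution:
  assumes "u \<in> {0..v}"
  shows "T \<phi> u = 1 - \<alpha> * \<mu> / c + \<alpha> / c * (\<integral>z. ext \<phi> (u - z) * kern z \<partial>lborel)"
proof -
  \<comment> \<open>Both cutoffs are encoded by zeros: \<open>kern\<close> vanishes for z < 0, and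
    \<open>ext \<phi>\<close> at u - z vanishes for z > u because the argument is negative. For z in
    [0, u] the argument stays in [0, v].\<close>
  have "indicator {0..u} z *\<^sub>R (\<phi> (u - z) * (1 - F z)) = ext \<phi> (u - z) * kern z" for z
    using assms by (auto simp: ext_def kern_def split: split_indicator)
  then show ?thesis
    by (simp add: renewal_op_def set_lebesgue_integral_def)
qed

lemma integrable_convolution:
  assumes "set_borel_measurable borel {0..v} \<phi>" and "\<And>x. x \<in> {0..v} \<Longrightarrow> \<bar>\<phi> x\<bar> \<le> B"
  shows "integrable lborel (\<lambda>z. ext \<phi> (u - z) * kern z)"
proof (rule Bochner_Integration.integrable_bound)
  note [measurable] = ext_measurable[OF assms(1)]
  \<comment> \<open>The modulus matters because v may be negative in this locale; the interval is
    then empty and B is unconstrained.\<close>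
  show "integrable lborel (\<lambda>z. \<bar>B\<bar> * kern z)"
    using integrable_kern by simp
  show "(\<lambda>z. ext \<phi> (u - z) * kern z) \<in> borel_measurable lborel"
    by measurable
  have "\<bar>ext \<phi> x\<bar> \<le> \<bar>B\<bar>" for x
    using assms(2)[of x] by (auto simp: ext_def split: split_indicator)
  then show "AE z in lborel. norm (ext \<phi> (u - z) * kern z) \<le> norm (\<bar>B\<bar> * kern z)"
    by (intro always_eventually allI) (simp add: abs_mult mult_right_mono)
qed

text \<open>The kernel has total mass \<mu>, and the prefactor \<alpha> / c makes the factor p. The
  bounds A and B serve integrability only and do not enter the estimate. Working pointwise with
  measurable functions covers a discontinuous starting iterate.\<close>

lemma renewal_op_contraction:
  assumes "set_borel_measurable borel {0..v} \<phi>" "\<And>x. x \<in> {0..v} \<Longrightarrow> \<bar>\<phi> x\<bar> \<le> A"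
    and "set_borel_measurable borel {0..v} \<psi>" "\<And>x. x \<in> {0..v} \<Longrightarrow> \<bar>\<psi> x\<bar> \<le> B"
    and d: "\<And>x. x \<in> {0..v} \<Longrightarrow> \<bar>\<phi> x - \<psi> x\<bar> \<le> D"
    and u: "u \<in> {0..v}"
  shows "\<bar>T \<phi> u - T \<psi> u\<bar> \<le> \<alpha> * \<mu> / c * D"
proof -
  have D: "0 \<le> D"
    using d[OF u] by linarith
  have i: "integrable lborel (\<lambda>z. ext \<phi> (u - z) * kern z)"
    "integrable lborel (\<lambda>z. ext \<psi> (u - z) * kern z)"
    using integrable_convolution assms by blast+
  have le: "\<bar>ext \<phi> x - ext \<psi> x\<bar> \<le> D" for x
    using d[of x] D by (auto simp: ext_def split: split_indicator)
  have "\<bar>(\<integral>z. ext \<phi> (u - z) * kern z \<partial>lborel) - (\<integral>z. ext \<psi> (u - z) * kern z \<partial>lborel)\<bar>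
      = \<bar>\<integral>z. ext \<phi> (u - z) * kern z - ext \<psi> (u - z) * kern z \<partial>lborel\<bar>"
    using i by simp
  also have "\<dots> \<le> (\<integral>z. \<bar>ext \<phi> (u - z) * kern z - ext \<psi> (u - z) * kern z\<bar> \<partial>lborel)"
    by (rule integral_abs_bound)
  also have "\<dots> \<le> (\<integral>z. D * kern z \<partial>lborel)"
  proof (rule integral_mono)
    show "\<bar>ext \<phi> (u - z) * kern z - ext \<psi> (u - z) * kern z\<bar> \<le> D * kern z" for z
      using le[of "u - z"] kern_nonneg[of z]
      by (simp add: left_diff_distrib[symmetric] abs_mult mult_right_mono)
  qed (use i integrable_kern in auto)
  also have "\<dots> = D * \<mu>"
    by (simp add: integral_kern)
  finally have "\<alpha> / c * \<bar>(\<integral>z. ext \<phi> (u - z) * kern z \<partial>lborel)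
      - (\<integral>z. ext \<psi> (u - z) * kern z \<partial>lborel)\<bar> \<le> \<alpha> / c * (D * \<mu>)"
    using \<alpha>_pos c_pos by (intro mult_left_mono) auto
  moreover have "T \<phi> u - T \<psi> u = \<alpha> / c * ((\<integral>z. ext \<phi> (u - z) * kern z \<partial>lborel)
      - (\<integral>z. ext \<psi> (u - z) * kern z \<partial>lborel))"
    by (simp add: renewal_op_eq_convolution[OF u] right_diff_distrib)
  ultimately show ?thesis
    using \<alpha>_pos c_pos by (simp add: abs_mult mult_ac)
qed

text \<open>The integral lies between 0 and \<mu>, which puts the value between 1 - p and 1.\<close>

lemma renewal_op_bounds:
  assumes "set_borel_measurable borel {0..v} \<phi>" and r: "\<phi> \<in> {0..v} \<rightarrow> {0..1}"
    and u: "u \<in> {0..v}" and p: "\<alpha> * \<mu> / c \<le> 1"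
  shows "T \<phi> u \<in> {0..1}"
proof -
  have i: "integrable lborel (\<lambda>z. ext \<phi> (u - z) * kern z)"
    by (rule integrable_convolution[OF assms(1), of 1]) (use r in \<open>auto simp: Pi_iff\<close>)
  have e: "0 \<le> ext \<phi> x" "ext \<phi> x \<le> 1" for x
    using r by (auto simp: ext_def Pi_iff split: split_indicator)
  have "0 \<le> (\<integral>z. ext \<phi> (u - z) * kern z \<partial>lborel)"
    by (intro Bochner_Integration.integral_nonneg) (simp add: e kern_nonneg)
  moreover have "(\<integral>z. ext \<phi> (u - z) * kern z \<partial>lborel) \<le> (\<integral>z. kern z \<partial>lborel)"
    by (intro integral_mono i integrable_kern) (simp add: e kern_nonneg mult_left_le_one_le)
  ultimately have "0 \<le> \<alpha> / c * (\<integral>z. ext \<phi> (u - z) * kern z \<partial>lborel)"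
    "\<alpha> / c * (\<integral>z. ext \<phi> (u - z) * kern z \<partial>lborel) \<le> \<alpha> / c * \<mu>"
    using \<alpha>_pos c_pos by (auto simp: integral_kern intro!: mult_left_mono divide_right_mono)
  then show ?thesis
    using p by (simp add: renewal_op_eq_convolution[OF u])
qed

text \<open>Increasing u raises the integrand and enlarges the range of integration; the added part
  contributes nonnegatively as \<phi> \<ge> 0.\<close>

lemma renewal_op_mono:
  assumes m: "mono_on {0..v} \<phi>" and r: "\<phi> \<in> {0..v} \<rightarrow> {0..1}"
  shows "mono_on {0..v} (T \<phi>)"
proof (rule mono_onI)
  fix u w assume uw: "u \<in> {0..v}" "w \<in> {0..v}" "u \<le> w"
  have i: "integrable lborel (\<lambda>z. ext \<phi> (x - z) * kern z)" for x
    by (rule integrable_convolution[OF mono_on_imp_set_borel_measurable[OF m borel_closed[OF closed_atLeastAtMost]], of 1])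
      (use r in \<open>auto simp: Pi_iff\<close>)
  have "ext \<phi> (u - z) * kern z \<le> ext \<phi> (w - z) * kern z" for z
  proof (cases "z \<ge> 0")
    case True
    \<comment> \<open>The extension is not monotone on the line, as it may drop after v, but z \<ge>
      0 keeps both arguments at most v.\<close>
    then have "ext \<phi> (u - z) \<le> ext \<phi> (w - z)"
      using uw mono_onD[OF m, of "u - z" "w - z"] r
      by (auto simp: ext_def Pi_iff split: split_indicator)
    then show ?thesis
      by (simp add: kern_nonneg mult_right_mono)
  qed (simp add: kern_def)
  then have "(\<integral>z. ext \<phi> (u - z) * kern z \<partial>lborel) \<le> (\<integral>z. ext \<phi> (w - z) * kern z \<partial>lborel)"
    by (intro integral_mono i)
  then show "T \<phi> u \<le> T \<phi> w"
    using \<alpha>_pos c_pos uw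
    by (auto simp: renewal_op_eq_convolution intro!: mult_left_mono divide_right_mono)
qed

text \<open>Interior discontinuities are those of a monotone function, outside [0, v] the extension
  is locally zero, and cutting off can create jumps only at 0 and v.\<close>

lemma countable_discont_ext:
  assumes "mono_on {0..v} \<phi>"
  shows "countable {x. \<not> isCont (ext \<phi>) x}"
proof (rule countable_subset)
  let ?D = "{x \<in> {0<..<v}. \<not> isCont \<phi> x}"
  show "countable (insert 0 (insert v ?D))"
    using mono_on_ctble_discont_open[of "{0<..<v}" \<phi>] mono_on_subset[OF assms, of "{0<..<v}"]
    by force
  have "isCont (ext \<phi>) x" if "x \<notin> insert 0 (insert v ?D)" for x
  proof (cases "x \<in> {0<..<v}")
    case True
    then have "eventually (\<lambda>y. y \<in> {0<..<v}) (nhds x)"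
      by (intro eventually_nhds_in_open) auto
    then have "eventually (\<lambda>y. ext \<phi> y = \<phi> y) (nhds x)"
      by eventually_elim (simp add: ext_def)
    then show ?thesis
      using True that isCont_cong by blast
  next
    case False
    then have "eventually (\<lambda>y. y \<in> - {0..v}) (nhds x)"
      using that by (intro eventually_nhds_in_open) auto
    then have "eventually (\<lambda>y. ext \<phi> y = 0) (nhds x)"
      by eventually_elim (simp add: ext_def)
    then show ?thesis
      using isCont_cong[of "ext \<phi>" "\<lambda>_. 0" x] by simp
  qed
  then show "{x. \<not> isCont (ext \<phi>) x} \<subseteq> insert 0 (insert v ?D)"
    by blast
qed

text \<open>Convolution smooths: moving u shifts the jumps of \<phi>, and these meet only a null set
  of z. The kernel itself dominates the integrands.\<close>

lemma renewal_op_continuous: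
  assumes m: "mono_on {0..v} \<phi>" and r: "\<phi> \<in> {0..v} \<rightarrow> {0..1}"
  shows "continuous_on {0..v} (T \<phi>)"
proof (rule continuous_on_sequentiallyI)
  fix X a assume X: "\<forall>n. X n \<in> {0..v}" and a: "a \<in> {0..v}" and lim: "X \<longlonglongrightarrow> a"
  note [measurable] = ext_measurable[OF mono_on_imp_set_borel_measurable[OF m borel_closed[OF closed_atLeastAtMost]]]
  \<comment> \<open>The integrand at z can fail to converge only if a - z is a discontinuity, so the
    exceptional set is the reflected translate of a countable set.\<close>
  have "countable ((\<lambda>x. a - x) ` {x. \<not> isCont (ext \<phi>) x})"
    using countable_discont_ext[OF m] by simp
  then have "AE z in lborel. z \<notin> (\<lambda>x. a - x) ` {x. \<not> isCont (ext \<phi>) x}"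
    by (intro AE_not_in countable_imp_null_set_lborel)
  then have ae: "AE z in lborel. (\<lambda>n. ext \<phi> (X n - z) * kern z) \<longlonglongrightarrow> ext \<phi> (a - z) * kern z"
  proof eventually_elim
    case (elim z)
    then have "isCont (ext \<phi>) (a - z)"
      by (force simp: image_iff)
    then show ?case
      by (intro tendsto_mult_right isCont_tendsto_compose[where g = "ext \<phi>"] tendsto_diff lim)
        simp_all
  qed
  have "(\<lambda>n. \<integral>z. ext \<phi> (X n - z) * kern z \<partial>lborel) \<longlonglongrightarrow> (\<integral>z. ext \<phi> (a - z) * kern z \<partial>lborel)"
  proof (rule integral_dominated_convergence[OF _ _ integrable_kern ae])
    have "\<bar>ext \<phi> x\<bar> \<le> 1" for x
      using r by (auto simp: ext_def Pi_iff split: split_indicator)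
    then show "AE z in lborel. norm (ext \<phi> (X n - z) * kern z) \<le> kern z" for n
      by (intro always_eventually allI)
        (simp add: abs_mult kern_nonneg mult_left_le_one_le)
  qed measurable
  then show "(\<lambda>n. T \<phi> (X n)) \<longlonglongrightarrow> T \<phi> a"
    using X a c_pos by (auto simp: renewal_op_eq_convolution intro!: tendsto_intros)
qed

end

section \<open>Successive approximations and their limit\<close>

theorem theorem3p1:
  fixes M :: "real measure" and F :: "real \<Rightarrow> real"
    and v \<alpha> c \<mu> p :: real and \<phi>s :: "nat \<Rightarrow> real \<Rightarrow> real"
  assumes "real_distribution M" and "F = cdf M" and "\<And>z. z \<le> 0 \<Longrightarrow> F z = 0"
    and "0 < v" and "\<alpha> > 0" and "c > 0"
    and "set_integrable lborel {0..} (\<lambda>z. 1 - F z)"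
    and "\<mu> = (LBINT z:{0..}. 1 - F z)"
    and "p = \<alpha> * \<mu> / c" and "p < 1"
    and "mono_on {0..v} (\<phi>s 0)" and "\<phi>s 0 \<in> {0..v} \<rightarrow> {0..1}"
    and "\<And>k u. u \<in> {0..v} \<Longrightarrow> \<phi>s (Suc k) u = renewal_op \<alpha> c \<mu> F (\<phi>s k) u"
  shows
    "(\<forall>k\<ge>1. continuous_on {0..v} (\<phi>s k) \<and> mono_on {0..v} (\<phi>s k)
        \<and> (\<forall>u\<in>{0..v}. 0 \<le> \<phi>s k u \<and> \<phi>s k u \<le> 1)) \<and>
     Metric_space.MCauchy (mspace (C_space v)) (mdist (C_space v))
        (\<lambda>k. restrict (\<phi>s (Suc k)) {0..v}) \<and>
     (\<exists>\<phi>. limitin (mtopology_of (C_space v)) (\<lambda>k. restrict (\<phi>s (Suc k)) {0..v})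
             (restrict \<phi> {0..v}) sequentially
        \<and> (\<forall>u\<in>{0..v}. \<phi> u = renewal_op \<alpha> c \<mu> F \<phi> u)
        \<and> (\<forall>\<psi>. continuous_on {0..v} \<psi> \<and> (\<forall>u\<in>{0..v}. \<psi> u = renewal_op \<alpha> c \<mu> F \<psi> u)
              \<longrightarrow> (\<forall>u\<in>{0..v}. \<psi> u = \<phi> u))
        \<and> (\<forall>k. max_norm v (\<lambda>u. \<phi> u - \<phi>s k u) \<le> p ^ k / (1 - p))
        \<and> (\<forall>u\<in>{0..v}. (\<lambda>k. \<phi>s k u) \<longlonglongrightarrow> \<phi> u)
        \<and> continuous_on {0..v} \<phi> \<and> mono_on {0..v} \<phi>
        \<and> (\<forall>u\<in>{0..v}. 0 \<le> \<phi> u \<and> \<phi> u \<le> 1))"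
proof -
  interpret real_distribution M by fact
  interpret renewal_kernel v \<alpha> c \<mu> F
  proof
    show "F \<in> borel_measurable borel"
      unfolding assms(2) by (intro borel_measurable_mono monoI cdf_nondecreasing)
    show "F z \<le> 1" for z
      unfolding assms(2) by (rule cdf_bounded_prob)
  qed fact+
  have p0: "0 \<le> p"
    unfolding assms(9) using \<mu>_nonneg assms(5,6) by simp
  have p1: "p < 1" by fact

  \<comment> \<open>The two properties are carried together: monotonicity gives measurability for
    the range bound, and the range gives the sign needed for monotonicity.\<close>
  have iter: "mono_on {0..v} (\<phi>s k) \<and> \<phi>s k \<in> {0..v} \<rightarrow> {0..1}" for k
  proof (induction k)
    case (Suc k)
    then have "mono_on {0..v} (T (\<phi>s k))" "T (\<phi>s k) \<in> {0..v} \<rightarrow> {0..1}"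
      using renewal_op_mono renewal_op_bounds mono_on_imp_set_borel_measurable assms(9,10)
      by (auto simp del: atLeastAtMost_iff)
    then show ?case
      using assms(13) by (simp add: mono_on_def Pi_iff)
  qed (use assms(11,12) in simp)
  then have mono: "mono_on {0..v} (\<phi>s k)" and range: "\<phi>s k \<in> {0..v} \<rightarrow> {0..1}" for k
    by auto
  have meas: "set_borel_measurable borel {0..v} (\<phi>s k)" for k
    by (rule mono_on_imp_set_borel_measurable[OF mono]) simp
  have bounds: "0 \<le> \<phi>s k u" "\<phi>s k u \<le> 1" "\<bar>\<phi>s k u\<bar> \<le> 1" if "u \<in> {0..v}" for k u
    using range[of k] that by (auto simp: Pi_iff)
  have cont: "continuous_on {0..v} (\<phi>s (Suc k))" for k
    using renewal_op_continuous[OF mono range, of k] assms(13)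
    by (subst continuous_on_cong[OF refl, of _ _ "T (\<phi>s k)"]) auto

  have step: "\<bar>\<phi>s (Suc k) u - \<phi>s k u\<bar> \<le> p ^ k" if "u \<in> {0..v}" for k u
    using that
  proof (induction k arbitrary: u)
    \<comment> \<open>Two values in [0, 1] differ by at most 1 = p^0.\<close>
    case 0
    then show ?case
      using bounds[of u 0] bounds[of u 1] by auto
  next
    case (Suc k)
    have "\<bar>T (\<phi>s (Suc k)) u - T (\<phi>s k) u\<bar> \<le> \<alpha> * \<mu> / c * p ^ k"
      by (rule renewal_op_contraction[OF meas bounds(3) meas bounds(3) Suc.IH Suc.prems])
    then show ?case
      using assms(9) Suc.prems by (simp add: assms(13))
  qed
  \<comment> \<open>Telescoping and the geometric series; the bound is independent of n, so it
    survives the passage to the limit.\<close>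
  have gap: "\<bar>\<phi>s (k + n) u - \<phi>s k u\<bar> \<le> p ^ k / (1 - p)" if u: "u \<in> {0..v}" for k n u
  proof -
    have "\<bar>\<phi>s (k + n) u - \<phi>s k u\<bar> \<le> (\<Sum>i<n. p ^ (k + i))"
    proof (induction n)
      case (Suc n)
      then show ?case
        using step[OF u, of "k + n"] by simp
    qed simp
    also have "\<dots> = p ^ k * (\<Sum>i<n. p ^ i)"
      by (simp add: power_add sum_distrib_left)
    also have "\<dots> \<le> p ^ k * (1 / (1 - p))"
      using p0 p1 by (intro mult_left_mono) (simp_all add: sum_gp_strict divide_right_mono)
    finally show ?thesis by simp
  qed
  have rate: "(\<lambda>k. p ^ k * C) \<longlonglongrightarrow> 0" for C
    by (rule tendsto_mult_left_zero) (use p0 p1 in \<open>simp add: LIMSEQ_power_zero\<close>)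
  have rate': "(\<lambda>k. p ^ k / (1 - p)) \<longlonglongrightarrow> 0"
    using rate[of "1 / (1 - p)"] by simp

  \<comment> \<open>The pointwise limit and the integral equation\<close>
  have "Cauchy (\<lambda>k. \<phi>s k u)" if u: "u \<in> {0..v}" for u
  proof (rule metric_CauchyI)
    fix e :: real assume "e > 0"
    then obtain N where N: "p ^ N / (1 - p) < e / 2"
      using order_tendstoD(2)[OF rate', of "e / 2"] by (auto simp: eventually_sequentially)
    have "dist (\<phi>s m u) (\<phi>s n u) < e" if "m \<ge> N" "n \<ge> N" for m n
      using gap[OF u, of N "m - N"] gap[OF u, of N "n - N"] that N
      unfolding dist_real_def le_add_diff_inverse[OF that(1)] le_add_diff_inverse[OF that(2)]
      by linarith
    then show "\<exists>N. \<forall>m\<ge>N. \<forall>n\<ge>N. dist (\<phi>s m u) (\<phi>s n u) < e"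
      by blast
  qed
  then have "\<exists>l. (\<lambda>k. \<phi>s k u) \<longlonglongrightarrow> l" if "u \<in> {0..v}" for u
    using that Cauchy_convergent convergent_def by blast
  then obtain \<phi> where lim: "(\<lambda>k. \<phi>s k u) \<longlonglongrightarrow> \<phi> u" if "u \<in> {0..v}" for u
    by metis

  have err: "\<bar>\<phi> u - \<phi>s k u\<bar> \<le> p ^ k / (1 - p)" if u: "u \<in> {0..v}" for k u
  proof (rule Lim_bounded)
    show "(\<lambda>n. \<bar>\<phi>s n u - \<phi>s k u\<bar>) \<longlonglongrightarrow> \<bar>\<phi> u - \<phi>s k u\<bar>"
      by (intro tendsto_intros lim[OF u])
    show "\<forall>n\<ge>k. \<bar>\<phi>s n u - \<phi>s k u\<bar> \<le> p ^ k / (1 - p)"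
      using gap[OF u, of k] by (metis le_add_diff_inverse)
  qed
  have \<phi>_bounds: "0 \<le> \<phi> u" "\<phi> u \<le> 1" if "u \<in> {0..v}" for u
    using LIMSEQ_le_const[OF lim[OF that]] LIMSEQ_le_const2[OF lim[OF that]] bounds[OF that]
    by blast+
  have \<phi>_mono: "mono_on {0..v} \<phi>"
  proof (rule mono_onI)
    fix u w assume "u \<in> {0..v}" "w \<in> {0..v}" "u \<le> w"
    then show "\<phi> u \<le> \<phi> w"
      using LIMSEQ_le[OF lim lim] mono_onD[OF mono] by blast
  qed
  have \<phi>_meas: "set_borel_measurable borel {0..v} \<phi>"
    by (rule mono_on_imp_set_borel_measurable[OF \<phi>_mono]) simp
  have \<phi>_abs: "\<bar>\<phi> u\<bar> \<le> 1" if "u \<in> {0..v}" for u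
    using \<phi>_bounds[OF that] by simp
  \<comment> \<open>The shifted iterates tend to \<phi> u and also to T \<phi> u: one contraction
    step turns the error p^k / (1 - p) into p^k * (p / (1 - p)).\<close>
  have fixpoint: "\<phi> u = T \<phi> u" if u: "u \<in> {0..v}" for u
  proof (rule LIMSEQ_unique)
    show "(\<lambda>k. \<phi>s (Suc k) u) \<longlonglongrightarrow> \<phi> u"
      by (rule LIMSEQ_Suc[OF lim[OF u]])
    have "\<bar>\<phi>s (Suc k) u - T \<phi> u\<bar> \<le> p ^ k * (p / (1 - p))" for k
    proof -
      have "\<bar>T \<phi> u - T (\<phi>s k) u\<bar> \<le> \<alpha> * \<mu> / c * (p ^ k / (1 - p))"
        by (rule renewal_op_contraction[OF \<phi>_meas \<phi>_abs meas bounds(3) err u])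
      then show ?thesis
        using assms(9,13) u by (simp add: mult_ac abs_minus_commute)
    qed
    then have "(\<lambda>k. \<phi>s (Suc k) u - T \<phi> u) \<longlonglongrightarrow> 0"
      by (intro Lim_null_comparison[OF _ rate[of "p / (1 - p)"]]) simp
    then show "(\<lambda>k. \<phi>s (Suc k) u) \<longlonglongrightarrow> T \<phi> u"
      by (simp add: LIM_zero_iff)
  qed
  \<comment> \<open>Continuity comes from \<phi> = T \<phi> and the monotonicity of \<phi>, without
    appeal to uniform limits.\<close>
  have \<phi>_cont: "continuous_on {0..v} \<phi>"
    using renewal_op_continuous[OF \<phi>_mono] \<phi>_bounds fixpoint
    by (subst continuous_on_cong[OF refl, of _ _ "T \<phi>"]) (auto simp: Pi_iff)
  have unique: "\<psi> u = \<phi> u"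
    if c: "continuous_on {0..v} \<psi>" and f: "\<forall>u\<in>{0..v}. \<psi> u = T \<psi> u" and u: "u \<in> {0..v}"
    for \<psi> u
  proof -
    have \<psi>_meas: "set_borel_measurable borel {0..v} \<psi>"
      unfolding set_borel_measurable_def
      by (rule borel_measurable_continuous_on_indicator[OF _ c]) simp
    obtain B where B: "\<bar>\<psi> x\<bar> \<le> B" if "x \<in> {0..v}" for x
      using compact_imp_bounded[OF compact_continuous_image[OF c compact_Icc]]
      by (auto simp: bounded_iff simp del: atLeastAtMost_iff)
    \<comment> \<open>A competing solution need not take values in [0, 1], so the initial distance
      is B + 1, with B from compactness and 1 bounding \<phi>. Both functions are fixed by T, so
      each application gains a factor p.\<close>
    have "\<bar>\<psi> x - \<phi> x\<bar> \<le> p ^ n * (B + 1)" if "x \<in> {0..v}" for x n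
      using that
    proof (induction n arbitrary: x)
      case 0
      then show ?case
        using B[of x] \<phi>_abs[of x] by simp
    next
      case (Suc n)
      have "\<bar>T \<psi> x - T \<phi> x\<bar> \<le> \<alpha> * \<mu> / c * (p ^ n * (B + 1))"
        by (rule renewal_op_contraction[OF \<psi>_meas B \<phi>_meas \<phi>_abs Suc.IH Suc.prems])
      then show ?case
        using assms(9) f fixpoint Suc.prems by (simp add: mult_ac)
    qed
    then have "\<bar>\<psi> u - \<phi> u\<bar> \<le> 0"
      using u by (intro LIMSEQ_le_const[OF rate[of "B + 1"]]) blast
    then show ?thesis by simp
  qed

  \<comment> \<open>Convergence in the space of continuous functions\<close>
  interpret C: Metric_space "mspace (C_space v)" "mdist (C_space v)"
    by (rule Metric_space_mspace_mdist)
  have in_C: "restrict f {0..v} \<in> mspace (C_space v)" if "continuous_on {0..v} f" for f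
  proof -
    have "continuous_on {0..v} (restrict f {0..v})"
      using that by (subst continuous_on_cong[OF refl, of _ _ f]) auto
    then show ?thesis
      \<comment> \<open>Compactness of [0, v] makes boundedness automatic, leaving continuity and
        extensionality.\<close>
      by (subst compactin_mspace_cfunspace)
        (auto simp: compactin_subtopology mtopology_of_euclidean simp del: restrict_apply)
  qed
  \<comment> \<open>The sequence starts with the first iterate because the initial one may be
    discontinuous; hence the exponent \<open>Suc k\<close>.\<close>
  have dist: "mdist (C_space v) (restrict (\<phi>s (Suc k)) {0..v}) (restrict \<phi> {0..v})
      \<le> p ^ Suc k / (1 - p)" for k
    by (rule mdist_cfunspace_le)
      (use p0 p1 err in \<open>auto simp: dist_real_def abs_minus_commute simp del: power_Suc\<close>)
  have conv: "limitin C.mtopology (\<lambda>k. restrict (\<phi>s (Suc k)) {0..v}) (restrict \<phi> {0..v})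
      sequentially"
    unfolding C.limitin_metric
  proof (intro conjI allI impI in_C \<phi>_cont)
    fix e :: real assume "e > 0"
    then have "\<forall>\<^sub>F k in sequentially. p ^ Suc k / (1 - p) < e"
      by (rule order_tendstoD(2)[OF LIMSEQ_Suc[OF rate']])
    then show "\<forall>\<^sub>F k in sequentially. restrict (\<phi>s (Suc k)) {0..v} \<in> mspace (C_space v) \<and>
        mdist (C_space v) (restrict (\<phi>s (Suc k)) {0..v}) (restrict \<phi> {0..v}) < e"
      by eventually_elim (use in_C cont dist in \<open>blast intro: le_less_trans\<close>)
  qed
  have cauchy: "C.MCauchy (\<lambda>k. restrict (\<phi>s (Suc k)) {0..v})"
    by (rule C.convergent_imp_MCauchy[OF _ conv]) (use in_C cont in blast)
  \<comment> \<open>This includes k = 0: the supremum is bounded pointwise and need not be attained.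
    Nonemptiness of [0, v] comes from 0 < v.\<close>
  have norm: "max_norm v (\<lambda>u. \<phi> u - \<phi>s k u) \<le> p ^ k / (1 - p)" for k
    unfolding max_norm_def using \<open>0 < v\<close> err by (intro cSUP_least) auto
  have "continuous_on {0..v} (\<phi>s k)" if "k \<ge> 1" for k
    using cont[of "k - 1"] that by simp
  then show ?thesis
    using mono bounds(1,2) cauchy conv fixpoint unique norm lim \<phi>_cont \<phi>_mono \<phi>_bounds
    unfolding mtopology_of_def by blast
qed

end
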